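(* Let $q\in(1,\infty)$. The $q$-root transform $$\varPhi_q:\Delta^q\longrightarrow\mathcal{U}_q,\qquad (p_n)\mapsto\big(p_n^{1/q}\big),$$ is an isometry between $(\Delta^q,\mathcal{F}^q)$ and $(\mathcal{U}_q,\|\cdot\|_{\ell^q})$.
   Context: Sequences are indexed by $n\in\mathbb{N}=\{0,1,2,\dots\}$. For $q\in(1,\infty)$, $\ell^q_{\mathbb{R}}$ is the space of real sequences with $\|(x_n)\|_{\ell^q}=\big(\sum_{n=0}^\infty|x_n|^q\big)^{1/q}<\infty$, and $\mathbb{S}(\ell^q_{\mathbb{R}})$ is its unit sphere. The set $\mathcal{U}_q$ is regarded as an open subset of the unit sphere $\mathbb{S}(\ell^q_{\mathbb{R}})$ and is given by $$\mathcal{U}_q=\{(x_n)\in\mathbb{S}(\ell^q_{\mathbb{R}}):x_n>0\ \ \forall n\in\mathbb{N}\};$$ it carries the Finsler metric given by the norm $\|\cdot\|_{\ell^q}$ on tangent vectors. Let $\Delta=\{(p_n)\in\ell^1_{\mathbb{R}}:\sum_{n=0}^\infty p_n=1,\ p_n>0\ \forall n\in\mathbb{N}\}$. $\Delta^q$ denotes the set $\Delta$ equipped with the differentiable structure for which the map $\varPhi_q:(p_n)\mapsto(p_n^{1/q})$ from $\Delta$ to $\mathcal{U}_q$ is a diffeomorphism. The tangent space at $(p_n)\in\Delta^q$ is $$T_{(p_n)}\Delta^q=\Big\{(v_n)\in\ell^1_{\mathbb{R}}:\ \sum_{n=0}^\infty v_n=0\ \text{ and }\ \big(v_n\,p_n^{1/q-1}\big)\in\ell^q_{\mathbb{R}}\Big\}.$$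 The $\ell^q$-Fisher–Rao metric, a Finsler metric on $\Delta^q$, is $$\mathcal{F}^q_{(p_n)}\big((v_n)\big)=\Big(\sum_{n=0}^\infty\Big|\frac{v_n}{p_n}\Big|^q p_n\Big)^{1/q},\qquad ((p_n),(v_n))\in T\Delta^q.$$
   Formalization: The metric on U_q is taken as q times the l^q norm: the differential of the q-root transform is v -> (1/q) p^(1/q-1) v, so its l^q norm is F^q/q, and the isometry as printed fails for every nonzero tangent vector v. *)

theory Defs
  imports Complex_Main
begin

type_synonym seq = "nat \<Rightarrow> real"

section \<open>Sequence spaces\<close>

definition lq :: "real \<Rightarrow> seq set" where
  "lq q = {x. summable (\<lambda>n. \<bar>x n\<bar> powr q)}"

definition lq_norm :: "real \<Rightarrow> seq \<Rightarrow> real" where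
  "lq_norm q x = (\<Sum>n. \<bar>x n\<bar> powr q) powr (1 / q)"

definition lq_sphere :: "real \<Rightarrow> seq set" where
  "lq_sphere q = {x \<in> lq q. lq_norm q x = 1}"

definition pos_sphere :: "real \<Rightarrow> seq set" where
  "pos_sphere q = {x \<in> lq_sphere q. \<forall>n. 0 < x n}"

definition simplex :: "seq set" where
  "simplex = {p \<in> lq 1. (\<Sum>n. p n) = 1 \<and> (\<forall>n. 0 < p n)}"

definition root_transform :: "real \<Rightarrow> seq \<Rightarrow> seq" where
  "root_transform q p = (\<lambda>n. p n powr (1 / q))"


section \<open>Finsler structures on sets of sequences\<close>

text \<open>
  The differentiable structure is recorded through its differentiable curves:
  \<open>velocity M c t v\<close> says that \<open>c\<close> runs in \<open>M\<close> near time \<open>t\<close>, is differentiable at \<open>t\<close>,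
  and that its velocity there is the tangent vector \<open>v\<close>. Charts are deliberately avoided: the
  positivity conditions do not define a norm-open subset of the unit sphere of an
  infinite-dimensional sequence space.
\<close>

record finsler =
  points :: "seq set"
  velocity :: "(real \<Rightarrow> seq) \<Rightarrow> real \<Rightarrow> seq \<Rightarrow> bool"
  tangent :: "seq \<Rightarrow> seq set"
  fnorm :: "seq \<Rightarrow> seq \<Rightarrow> real"

definition differentiable_curve :: "finsler \<Rightarrow> (real \<Rightarrow> seq) \<Rightarrow> real \<Rightarrow> bool" where
  "differentiable_curve M c t \<longleftrightarrow> (\<exists>v. velocity M c t v)"

text \<open>
  The first conjunct makes \<open>D\<close> unique on the tangent space: every tangent vector is the
  velocity of some curve.
\<close>

definition is_differential ::
    "finsler \<Rightarrow> finsler \<Rightarrow> (seq \<Rightarrow> seq) \<Rightarrow> seq \<Rightarrow> (seq \<Rightarrow> seq) \<Rightarrow> bool" where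
  "is_differential M N f p D \<longleftrightarrow>
     (\<forall>v \<in> tangent M p. \<exists>c. c 0 = p \<and> velocity M c 0 v) \<and>
     (\<forall>c t v. c t = p \<and> velocity M c t v \<longrightarrow> v \<in> tangent M p \<and> velocity N (f \<circ> c) t (D v))"

definition linear_on_seqs :: "seq set \<Rightarrow> (seq \<Rightarrow> seq) \<Rightarrow> bool" where
  "linear_on_seqs T D \<longleftrightarrow>
     (\<forall>u \<in> T. \<forall>v \<in> T. \<forall>a b. D (\<lambda>n. a * u n + b * v n) = (\<lambda>n. a * D u n + b * D v n))"

definition finsler_diffeo :: "finsler \<Rightarrow> finsler \<Rightarrow> (seq \<Rightarrow> seq) \<Rightarrow> bool" where
  "finsler_diffeo M N f \<longleftrightarrow>
     bij_betw f (points M) (points N) \<and>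
     (\<forall>c t. (\<forall>\<^sub>F s in nhds t. c s \<in> points M) \<longrightarrow>
        (differentiable_curve M c t \<longleftrightarrow> differentiable_curve N (f \<circ> c) t))"

definition finsler_isometry :: "finsler \<Rightarrow> finsler \<Rightarrow> (seq \<Rightarrow> seq) \<Rightarrow> bool" where
  "finsler_isometry M N f \<longleftrightarrow>
     finsler_diffeo M N f \<and>
     (\<forall>p \<in> points M. \<exists>D.
        is_differential M N f p D \<and>
        linear_on_seqs (tangent M p) D \<and>
        bij_betw D (tangent M p) (tangent N (f p)) \<and>
        (\<forall>v \<in> tangent M p. fnorm N (f p) (D v) = fnorm M p v))"

text \<open>
  Needed because differentiating \<open>p \<mapsto> p powr (1 / q)\<close> produces a factor \<open>1 / q\<close>, which neither the
  Fisher--Rao metric nor the \<open>\<ell>\<^sup>q\<close> norm below absorbs.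
\<close>

definition scale_metric :: "real \<Rightarrow> finsler \<Rightarrow> finsler" where
  "scale_metric k M = M\<lparr>fnorm := \<lambda>p v. k * fnorm M p v\<rparr>"


section \<open>The positive part of the unit sphere\<close>

definition lq_velocity :: "real \<Rightarrow> seq set \<Rightarrow> (real \<Rightarrow> seq) \<Rightarrow> real \<Rightarrow> seq \<Rightarrow> bool" where
  "lq_velocity q A c t w \<longleftrightarrow>
     (\<forall>\<^sub>F s in nhds t. c s \<in> A) \<and> w \<in> lq q \<and>
     ((\<lambda>s. lq_norm q (\<lambda>n. (c s n - c t n) / (s - t) - w n)) \<longlongrightarrow> 0) (at t)"

text \<open>The tangent spaces are those of the whole unit sphere.\<close>

definition sphere_tangent :: "real \<Rightarrow> seq \<Rightarrow> seq set" where
  "sphere_tangent q x = {w. \<exists>c. c 0 = x \<and> lq_velocity q (lq_sphere q) c 0 w}"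

definition pos_sphere_finsler :: "real \<Rightarrow> finsler" where
  "pos_sphere_finsler q =
     \<lparr>points = pos_sphere q,
      velocity = lq_velocity q (pos_sphere q),
      tangent = sphere_tangent q,
      fnorm = (\<lambda>x w. lq_norm q w)\<rparr>"


section \<open>The simplex with the Fisher--Rao metric\<close>

text \<open>
  The differentiable structure is pulled back along the root transform. Tangent vectors are
  written in the ambient coordinates of the simplex, hence the coordinatewise derivative.
\<close>

definition simplex_velocity :: "real \<Rightarrow> (real \<Rightarrow> seq) \<Rightarrow> real \<Rightarrow> seq \<Rightarrow> bool" where
  "simplex_velocity q c t v \<longleftrightarrow>
     (\<forall>\<^sub>F s in nhds t. c s \<in> simplex) \<and>
     (\<exists>w. lq_velocity q (pos_sphere q) (root_transform q \<circ> c) t w) \<and>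
     (\<forall>n. ((\<lambda>s. c s n) has_real_derivative v n) (at t))"

definition simplex_tangent :: "real \<Rightarrow> seq \<Rightarrow> seq set" where
  "simplex_tangent q p =
     {v \<in> lq 1. (\<Sum>n. v n) = 0 \<and> (\<lambda>n. v n * p n powr (1 / q - 1)) \<in> lq q}"

definition fisher_rao :: "real \<Rightarrow> seq \<Rightarrow> seq \<Rightarrow> real" where
  "fisher_rao q p v = (\<Sum>n. \<bar>v n / p n\<bar> powr q * p n) powr (1 / q)"

definition simplex_finsler :: "real \<Rightarrow> finsler" where
  "simplex_finsler q =
     \<lparr>points = simplex,
      velocity = simplex_velocity q,
      tangent = simplex_tangent q,
      fnorm = fisher_rao q\<rparr>"

end

theory Submission
  imports Defs "HOL-Analysis.Uniform_Limit" "HOL-Analysis.Convex"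
begin

text \<open>
  The differential of \<open>p \<mapsto> p powr (1 / q)\<close> at \<open>p\<close> multiplies \<open>v\<close> by \<open>p powr (1 / q - 1) / q\<close>
  coordinatewise, and carrying the Fisher--Rao norm over to \<open>q\<close> times the \<open>\<ell>\<^sup>q\<close> norm is then a
  computation. The substance lies in the tangent spaces: at a point \<open>x\<close> of the positive sphere the
  tangent vectors are exactly the \<open>w\<close> in \<open>\<ell>\<^sup>q\<close> annihilated by the functional
  \<open>w \<mapsto> \<Sum>n. x n powr (q - 1) * w n\<close>, which corresponds to \<open>(\<Sum>n. v n) = 0\<close> on the simplex.
  Velocities are annihilated because this functional is at most \<open>1\<close> on the sphere and attains \<open>1\<close>
  at \<open>x\<close>. Conversely, an annihilated \<open>w\<close> is the velocity of a normalised perturbation of \<open>x\<close>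
  whose coordinates stay positive.
\<close>

section \<open>Convexity estimates for real powers\<close>

text \<open>Weighted arithmetic-geometric mean for \<open>x powr q\<close> and
  \<open>\<bar>y\<bar> powr q\<close> with weights \<open>1 - 1/q\<close> and \<open>1/q\<close>,
  multiplied through by \<open>q\<close>. The case \<open>y = 0\<close> is split off because the
  library inequality takes positive arguments.\<close>

lemma Young_powr:
  fixes q x y :: real
  assumes "1 < q" "0 < x"
  shows "q * (x powr (q - 1) * \<bar>y\<bar>) \<le> \<bar>y\<bar> powr q + (q - 1) * x powr q"
proof (cases "y = 0")
  case False
  have "(x powr q) powr (1 - 1/q) * (\<bar>y\<bar> powr q) powr (1/q)
      \<le> (1 - 1/q) * x powr q + (1/q) * \<bar>y\<bar> powr q"
    by (rule Youngs_inequality_0) (use assms False in auto)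
  moreover have "(x powr q) powr (1 - 1/q) = x powr (q - 1)"
    using assms by (simp add: powr_powr right_diff_distrib)
  ultimately have "x powr (q - 1) * \<bar>y\<bar> \<le> (1 - 1/q) * x powr q + (1/q) * \<bar>y\<bar> powr q"
    using assms by (simp add: powr_powr)
  then have "q * (x powr (q - 1) * \<bar>y\<bar>) \<le> q * ((1 - 1/q) * x powr q + (1/q) * \<bar>y\<bar> powr q)"
    using assms by (intro mult_left_mono) auto
  also have "\<dots> = (q * (1 - 1/q)) * x powr q + (q * (1/q)) * \<bar>y\<bar> powr q"
    by (simp only: distrib_left mult.assoc)
  also have "\<dots> = \<bar>y\<bar> powr q + (q - 1) * x powr q"
    using assms by (simp add: right_diff_distrib)
  finally show ?thesis .
qed (use assms in simp)

text \<open>Convexity of \<open>\<bar>y\<bar> powr q\<close>, with the tangent taken at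
  \<open>x\<close>. The sign of \<open>y\<close> is free because the estimate is later summed over
  arbitrary points of the whole sphere.\<close>

lemma powr_tangent_le:
  fixes q x y :: real
  assumes "1 < q" "0 < x"
  shows "x powr q + q * x powr (q - 1) * (y - x) \<le> \<bar>y\<bar> powr q"
proof -
  have "x powr q = x powr (q - 1) * x"
    using assms by (simp add: powr_diff)
  moreover have "q * x powr (q - 1) * y \<le> q * x powr (q - 1) * \<bar>y\<bar>"
    using assms by (intro mult_left_mono) auto
  ultimately show ?thesis
    using Young_powr[OF assms, of y] by (simp add: algebra_simps)
qed

text \<open>The tangent inequality, taken once at each of the two points, bounds the difference from
  both sides; the slopes are at most the slope at \<open>b\<close>.\<close>

lemma powr_diff_bound:
  fixes q x y :: real
  assumes "1 < q" "0 < x" "0 < y" "x \<le> b" "y \<le> b"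
  shows "\<bar>y powr q - x powr q\<bar> \<le> q * b powr (q - 1) * \<bar>y - x\<bar>"
proof -
  have *: "v powr q - u powr q \<le> q * b powr (q - 1) * \<bar>v - u\<bar>"
    if "0 < u" "0 < v" "u \<le> b" "v \<le> b" for u v
  proof -
    have "v powr q - u powr q \<le> q * v powr (q - 1) * (v - u)"
      using powr_tangent_le[of q v u] assms that by (simp add: algebra_simps)
    also have "\<dots> \<le> q * v powr (q - 1) * \<bar>v - u\<bar>"
      using assms by (intro mult_left_mono) auto
    also have "\<dots> \<le> q * b powr (q - 1) * \<bar>v - u\<bar>"
      using assms that by (intro mult_right_mono mult_left_mono powr_mono2) auto
    finally show ?thesis .
  qed
  from *[of x y] *[of y x] assms show ?thesis
    by (simp add: abs_minus_commute abs_le_iff)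
qed

text \<open>Dominated convergence for series, from Tannery's theorem: the bound holds for all
  \<open>k\<close> at once, so the product filter imposes a condition on \<open>s\<close>
  only.\<close>

lemma tendsto_suminf_dominated:
  fixes a :: "nat \<Rightarrow> 'b \<Rightarrow> real"
  assumes "\<And>k. ((\<lambda>s. a k s) \<longlongrightarrow> b k) F"
    and "\<forall>\<^sub>F s in F. \<forall>k. \<bar>a k s\<bar> \<le> M k" and "summable M" and "F \<noteq> bot"
  shows "((\<lambda>s. \<Sum>k. a k s) \<longlongrightarrow> (\<Sum>k. b k)) F"
proof -
  have "eventually (\<lambda>(k, s). norm (a k s) \<le> M k) (at_top \<times>\<^sub>F F)"
    unfolding eventually_prod_filter
    using assms(2)
    by (intro exI[of _ "\<lambda>_. True"] exI[of _ "\<lambda>s. \<forall>k. \<bar>a k s\<bar> \<le> M k"]) simp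
  from tannerys_theorem[OF assms(1) this assms(3,4)] show ?thesis
    by blast
qed

section \<open>The space \<open>lq\<close> and its norm\<close>

lemma lq_bound:
  assumes "y \<in> lq q" "0 \<le> q" "\<And>n. \<bar>x n\<bar> \<le> \<bar>y n\<bar>"
  shows "x \<in> lq q"
  using assms unfolding lq_def
  by (auto intro!: summable_comparison_test'[of "\<lambda>n. \<bar>y n\<bar> powr q" 0] powr_mono2)

lemma lq_scale: "x \<in> lq q \<Longrightarrow> (\<lambda>n. a * x n) \<in> lq q"
  by (simp add: lq_def abs_mult powr_mult summable_mult)

text \<open>A sum is at most twice its larger term in absolute value. This quasi-triangle inequality
  yields closure of \<open>lq\<close> under addition.\<close>

lemma powr_add_le:
  fixes a b q :: real
  assumes "0 \<le> q" 
  shows "\<bar>a + b\<bar> powr q \<le> 2 powr q * (\<bar>a\<bar> powr q + \<bar>b\<bar> powr q)"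
proof -
  have "\<bar>a + b\<bar> powr q \<le> (2 * max \<bar>a\<bar> \<bar>b\<bar>) powr q"
    using assms by (intro powr_mono2) auto
  also have "\<dots> = 2 powr q * max \<bar>a\<bar> \<bar>b\<bar> powr q"
    by (simp add: powr_mult)
  also have "\<dots> \<le> 2 powr q * (\<bar>a\<bar> powr q + \<bar>b\<bar> powr q)"
    by (intro mult_left_mono) (auto simp: max_def)
  finally show ?thesis .
qed

lemma lq_add:
  assumes "0 \<le> q" "x \<in> lq q" "y \<in> lq q"
  shows "(\<lambda>n. x n + y n) \<in> lq q"
proof -
  have "summable (\<lambda>n. 2 powr q * (\<bar>x n\<bar> powr q + \<bar>y n\<bar> powr q))"
    using assms by (auto simp: lq_def intro!: summable_mult summable_add)
  then show ?thesis
    unfolding lq_def mem_Collect_eq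
    by (rule summable_comparison_test'[of _ 0]) (use powr_add_le[OF assms(1)] in simp)
qed

lemma lq_diff:
  assumes "0 \<le> q" "x \<in> lq q" "y \<in> lq q"
  shows "(\<lambda>n. x n - y n) \<in> lq q"
  using lq_add[OF assms(1,2) lq_scale[OF assms(3), of "-1"]] by simp

lemma lq_abs: "x \<in> lq q \<Longrightarrow> (\<lambda>n. \<bar>x n\<bar>) \<in> lq q"
  by (simp add: lq_def)

lemma lq_norm_nonneg: "0 \<le> lq_norm q x"
  by (simp add: lq_norm_def)

lemma lq_norm_powr:
  assumes "0 < q" "x \<in> lq q"
  shows "lq_norm q x powr q = (\<Sum>n. \<bar>x n\<bar> powr q)"
proof -
  have "0 \<le> (\<Sum>n. \<bar>x n\<bar> powr q)"
    using assms by (intro suminf_nonneg) (auto simp: lq_def)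
  then show ?thesis
    using assms by (simp add: lq_norm_def powr_powr)
qed

lemma lq_norm_scale:
  assumes "0 < q" "x \<in> lq q"
  shows "lq_norm q (\<lambda>n. a * x n) = \<bar>a\<bar> * lq_norm q x"
proof -
  have "0 \<le> (\<Sum>n. \<bar>x n\<bar> powr q)"
    using assms by (intro suminf_nonneg) (auto simp: lq_def)
  then show ?thesis
    using assms by (simp add: lq_norm_def lq_def abs_mult powr_mult suminf_mult powr_powr)
qed

lemma abs_le_lq_norm:
  assumes "0 < q" "x \<in> lq q"
  shows "\<bar>x n\<bar> \<le> lq_norm q x"
proof -
  have "sum (\<lambda>n. \<bar>x n\<bar> powr q) {n} \<le> (\<Sum>n. \<bar>x n\<bar> powr q)"
    using assms by (intro sum_le_suminf) (auto simp: lq_def)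
  then have "(\<bar>x n\<bar> powr q) powr (1/q) \<le> lq_norm q x"
    using assms unfolding lq_norm_def by (intro powr_mono2) auto
  then show ?thesis
    using assms by (simp add: powr_powr)
qed

section \<open>The spheres and the supporting functional at a positive point\<close>

lemma lq_sphereD:
  assumes "0 < q" "x \<in> lq_sphere q"
  shows "x \<in> lq q" "(\<Sum>n. \<bar>x n\<bar> powr q) = 1"
  using assms lq_norm_powr[of q x] by (auto simp: lq_sphere_def)

lemma lq_sphereI: "x \<in> lq q \<Longrightarrow> (\<Sum>n. \<bar>x n\<bar> powr q) = 1 \<Longrightarrow> x \<in> lq_sphere q"
  by (simp add: lq_sphere_def lq_norm_def)

lemma pos_sphereD:
  assumes "0 < q" "x \<in> pos_sphere q"
  shows "x \<in> lq q" "\<And>n. 0 < x n" "summable (\<lambda>n. x n powr q)" "(\<Sum>n. x n powr q) = 1"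
proof -
  show pos: "\<And>n. 0 < x n" and "x \<in> lq q"
    using assms by (auto simp: pos_sphere_def lq_sphere_def)
  have "\<bar>x n\<bar> powr q = x n powr q" for n
    using pos[of n] by simp
  then show "summable (\<lambda>n. x n powr q)" "(\<Sum>n. x n powr q) = 1"
    using lq_sphereD[of q x] assms by (auto simp: pos_sphere_def lq_def)
qed

text \<open>Young's inequality dominates the pairing termwise by a combination of the summable
  series of \<open>\<bar>d n\<bar> powr q\<close> and \<open>x n powr q\<close>.\<close>

lemma summable_dual:
  assumes "1 < q" "x \<in> pos_sphere q" "d \<in> lq q"
  shows "summable (\<lambda>n. x n powr (q - 1) * \<bar>d n\<bar>)" "summable (\<lambda>n. x n powr (q - 1) * d n)"
proof -
  note x = pos_sphereD[OF _ assms(2)]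
  have le: "q * (x n powr (q - 1) * \<bar>d n\<bar>) \<le> \<bar>d n\<bar> powr q + (q - 1) * x n powr q" for n
    using Young_powr[OF assms(1) x(2), of n "d n"] assms(1) by (simp add: mult.assoc)
  have "summable (\<lambda>n. \<bar>d n\<bar> powr q + (q - 1) * x n powr q)"
    using assms x by (auto intro!: summable_add summable_mult simp: lq_def)
  then have "summable (\<lambda>n. q * (x n powr (q - 1) * \<bar>d n\<bar>))"
    by (rule summable_comparison_test'[of _ 0]) (use le assms in simp)
  then show 1: "summable (\<lambda>n. x n powr (q - 1) * \<bar>d n\<bar>)"
    using assms by (subst (asm) summable_cmult_iff) auto
  show "summable (\<lambda>n. x n powr (q - 1) * d n)"
    by (rule summable_comparison_test'[OF 1, of 0]) (simp add: abs_mult)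
qed

text \<open>Hoelder's inequality: \<open>x n powr (q - 1)\<close> has norm 1 for the conjugate
  exponent \<open>q / (q - 1)\<close>. After rescaling \<open>d\<close> to norm 1, the right-hand
  sides of Young's inequality sum to \<open>1 + (q - 1) = q\<close>.\<close>

lemma Holder_pos_sphere:
  assumes "1 < q" "x \<in> pos_sphere q" "d \<in> lq q"
  shows "\<bar>\<Sum>n. x n powr (q - 1) * d n\<bar> \<le> lq_norm q d"
proof (cases "lq_norm q d = 0")
  case True
  then have "d n = 0" for n
    using abs_le_lq_norm[of q d n] assms by auto
  then show ?thesis
    using True by simp
next
  case False
  define N where "N = lq_norm q d"
  have N: "0 < N"
    using False lq_norm_nonneg[of q d] by (simp add: N_def)
  note x = pos_sphereD[OF _ assms(2)]
  define e where "e = (\<lambda>n. (1/N) * d n)"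
  have e: "e \<in> lq q" unfolding e_def by (rule lq_scale) fact
  have "lq_norm q e = 1"
    unfolding e_def using lq_norm_scale[of q d "1 / N"] assms N
    by (simp add: N_def[symmetric])
  then have e1: "(\<Sum>n. \<bar>e n\<bar> powr q) = 1"
    using lq_norm_powr[OF _ e] assms by simp
  have le: "q * (x n powr (q - 1) * \<bar>e n\<bar>) \<le> \<bar>e n\<bar> powr q + (q - 1) * x n powr q" for n
    using Young_powr[OF assms(1) x(2), of n "e n"] assms(1) by (simp add: mult.assoc)
  have "q * (\<Sum>n. x n powr (q - 1) * \<bar>e n\<bar>) = (\<Sum>n. q * (x n powr (q - 1) * \<bar>e n\<bar>))"
    using summable_dual[OF assms(1,2) e] by (simp add: suminf_mult)
  also have "\<dots> \<le> (\<Sum>n. \<bar>e n\<bar> powr q + (q - 1) * x n powr q)"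
    using le summable_dual[OF assms(1,2) e] e x assms(1)
    by (intro suminf_le) (auto intro!: summable_mult summable_add simp: lq_def)
  also have "\<dots> = q"
    using e x assms(1) by (subst suminf_add[symmetric])
       (auto intro!: summable_mult simp: lq_def suminf_mult e1)
  finally have "(\<Sum>n. x n powr (q - 1) * \<bar>e n\<bar>) \<le> 1"
    using assms(1) by simp
  moreover have "\<bar>\<Sum>n. x n powr (q - 1) * e n\<bar> \<le> (\<Sum>n. x n powr (q - 1) * \<bar>e n\<bar>)"
    using summable_rabs[of "\<lambda>n. x n powr (q - 1) * e n"] summable_dual[OF assms(1,2) e]
    by (simp add: abs_mult)
  moreover have "(\<Sum>n. x n powr (q - 1) * e n) = (1/N) * (\<Sum>n. x n powr (q - 1) * d n)"
    using summable_dual(2)[OF assms] suminf_mult[of "\<lambda>n. x n powr (q - 1) * d n" "1/N"]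
    unfolding e_def by (simp add: mult.left_commute)
  ultimately have "\<bar>(\<Sum>n. x n powr (q - 1) * d n) / N\<bar> \<le> 1"
    by simp
  then show ?thesis
    using N by (simp add: N_def[symmetric] abs_divide divide_le_eq)
qed

section \<open>Velocities of curves in \<open>lq\<close> and in the sphere\<close>

text \<open>\<open>lq_norm\<close> carries information only on \<open>lq\<close>, since the sum of a
  divergent series is an unspecified value. Norm bounds on difference quotients therefore rest on
  this membership.\<close>

lemma lq_velocity_quotient:
  assumes "0 < q" "A \<subseteq> lq q" "lq_velocity q A c t w"
  shows "c t \<in> A" "\<forall>\<^sub>F s in at t. c s \<in> A \<and> (\<lambda>n. (c s n - c t n) / (s - t) - w n) \<in> lq q"
proof -
  from assms have ev: "\<forall>\<^sub>F s in nhds t. c s \<in> A" and w: "w \<in> lq q"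
    by (auto simp: lq_velocity_def)
  show ct: "c t \<in> A"
    using eventually_nhds_x_imp_x[OF ev] .
  have "\<forall>\<^sub>F s in at t. c s \<in> A"
    using ev eventually_nhds_conv_at by blast
  then show "\<forall>\<^sub>F s in at t. c s \<in> A \<and> (\<lambda>n. (c s n - c t n) / (s - t) - w n) \<in> lq q"
  proof eventually_elim
    case (elim s)
    have "(\<lambda>n. (1/(s-t)) * (c s n - c t n) - w n) \<in> lq q"
      using elim ct w assms by (intro lq_diff lq_scale) auto
    then show ?case using elim by simp
  qed
qed

lemma lq_velocity_coordinate:
  assumes "0 < q" "A \<subseteq> lq q" "lq_velocity q A c t w"
  shows "((\<lambda>s. c s n) has_real_derivative w n) (at t)"
proof -
  have "((\<lambda>s. (c s n - c t n) / (s - t) - w n) \<longlongrightarrow> 0) (at t)"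
  proof (rule Lim_null_comparison)
    show "\<forall>\<^sub>F s in at t. norm ((c s n - c t n) / (s - t) - w n)
        \<le> lq_norm q (\<lambda>n. (c s n - c t n) / (s - t) - w n)"
      using lq_velocity_quotient(2)[OF assms]
      by eventually_elim (use abs_le_lq_norm[OF assms(1)] in fastforce)
    show "((\<lambda>s. lq_norm q (\<lambda>n. (c s n - c t n) / (s - t) - w n)) \<longlongrightarrow> 0) (at t)"
      using assms by (simp add: lq_velocity_def)
  qed
  then show ?thesis
    by (simp add: has_field_derivative_iff Lim_null[symmetric])
qed

text \<open>Only the base point is positive; the curve may run through the whole sphere, as in
  \<open>sphere_tangent\<close>. Along it the functional is maximal at time \<open>t\<close>, so its
  derivative there vanishes.\<close>

lemma dual_velocity_eq_0:
  assumes "1 < q" "c t \<in> pos_sphere q" "lq_velocity q (lq_sphere q) c t w"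
  shows "(\<Sum>n. c t n powr (q - 1) * w n) = 0"
proof -
  define x where "x = c t"
  define L where "L = (\<lambda>d. \<Sum>n. x n powr (q - 1) * d n)"
  have x: "x \<in> pos_sphere q" using assms by (simp add: x_def)
  note xD = pos_sphereD[OF _ x]
  have w: "w \<in> lq q" using assms by (simp add: lq_velocity_def)
  have sub: "lq_sphere q \<subseteq> lq q" by (auto simp: lq_sphere_def)
  note quot = lq_velocity_quotient(2)[OF _ sub assms(3)]
  have L_diff: "L (\<lambda>n. a * (y n - x n) - w n) = a * L (\<lambda>n. y n - x n) - L w" 
    if "y \<in> lq q" for a y
  proof -
    have d: "(\<lambda>n. y n - x n) \<in> lq q"
      using that xD assms(1) by (intro lq_diff) auto
    have "L (\<lambda>n. a * (y n - x n) - w n)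
       = (\<Sum>n. a * (x n powr (q - 1) * (y n - x n)) - x n powr (q - 1) * w n)"
      unfolding L_def by (simp add: algebra_simps)
    also have "\<dots> = a * L (\<lambda>n. y n - x n) - L w"
      unfolding L_def using summable_dual(2)[OF assms(1) x w] summable_dual(2)[OF assms(1) x d]
      by (subst suminf_diff[symmetric]) (auto intro!: summable_mult simp: suminf_mult)
    finally show ?thesis .
  qed
  \<comment> \<open>The unit ball lies on one side of its supporting hyperplane at \<open>x\<close>.\<close>
  have L_le: "L (\<lambda>n. y n - x n) \<le> 0" if "y \<in> lq_sphere q" for y
  proof -
    note y = lq_sphereD[OF _ that]
    have d: "(\<lambda>n. y n - x n) \<in> lq q"
      using y xD assms(1) by (intro lq_diff) auto
    note sd = summable_dual(2)[OF assms(1) x d]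
    have "(\<Sum>n. x n powr q + q * (x n powr (q - 1) * (y n - x n))) \<le> (\<Sum>n. \<bar>y n\<bar> powr q)"
      using powr_tangent_le[OF assms(1) xD(2)] sd xD y assms(1)
      by (intro suminf_le) (auto intro!: summable_add summable_mult simp: lq_def mult.assoc)
    moreover have "(\<Sum>n. x n powr q + q * (x n powr (q - 1) * (y n - x n)))
        = 1 + q * L (\<lambda>n. y n - x n)"
      using sd xD assms(1) unfolding L_def
      by (subst suminf_add[symmetric]) (auto intro!: summable_mult simp: suminf_mult)
    ultimately show ?thesis
      using y assms(1) by (simp add: mult_le_0_iff)
  qed
  \<comment> \<open>By Hoelder the functional has norm at most 1, so convergence of the difference
    quotients to \<open>w\<close> in norm passes to their images under \<open>L\<close>.\<close>
  have lim: "((\<lambda>s. L (\<lambda>n. c s n - x n) / (s - t) - L w) \<longlongrightarrow> 0) (at t)"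
  proof (rule Lim_null_comparison)
    show "\<forall>\<^sub>F s in at t. norm (L (\<lambda>n. c s n - x n) / (s - t) - L w)
        \<le> lq_norm q (\<lambda>n. (c s n - c t n) / (s - t) - w n)"
      using quot[OF less_trans[OF zero_less_one assms(1)]]
    proof eventually_elim
      case (elim s)
      then have "c s \<in> lq q" using sub by auto
      from L_diff[OF this, of "1/(s-t)"] elim Holder_pos_sphere[OF assms(1) x, of "\<lambda>n. (c s n - c t n) / (s - t) - w n"]
      show ?case unfolding L_def x_def by simp
    qed
    show "((\<lambda>s. lq_norm q (\<lambda>n. (c s n - c t n) / (s - t) - w n)) \<longlongrightarrow> 0) (at t)"
      using assms by (simp add: lq_velocity_def)
  qed
  then have lim: "((\<lambda>s. L (\<lambda>n. c s n - x n) / (s - t)) \<longlongrightarrow> L w) (at t)"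
    by (simp add: Lim_null[symmetric])
  have ev: "\<forall>\<^sub>F s in at t. c s \<in> lq_sphere q"
    using assms(3) eventually_nhds_conv_at unfolding lq_velocity_def by blast
  \<comment> \<open>The numerators are nonpositive on both sides of \<open>t\<close> while
    \<open>s - t\<close> changes sign, so the two one-sided limits give opposite
    inequalities.\<close>
  have "L w \<le> 0"
  proof (rule tendsto_upperbound)
    show "((\<lambda>s. L (\<lambda>n. c s n - x n) / (s - t)) \<longlongrightarrow> L w) (at_right t)"
      using lim by (rule filterlim_mono) (auto intro: at_le)
    have "\<forall>\<^sub>F s in at_right t. c s \<in> lq_sphere q"
      using ev at_le[of "{t<..}" UNIV t] by (auto simp: le_filter_def)
    then show "\<forall>\<^sub>F s in at_right t. L (\<lambda>n. c s n - x n) / (s - t) \<le> 0"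
      using eventually_at_right_less[of t]
      by eventually_elim (use L_le in \<open>auto simp: divide_le_0_iff\<close>)
  qed auto
  moreover have "0 \<le> L w"
  proof (rule tendsto_lowerbound)
    show "((\<lambda>s. L (\<lambda>n. c s n - x n) / (s - t)) \<longlongrightarrow> L w) (at_left t)"
      using lim by (rule filterlim_mono) (auto intro: at_le)
    have "\<forall>\<^sub>F s in at_left t. c s \<in> lq_sphere q"
      using ev at_le[of "{..<t}" UNIV t] by (auto simp: le_filter_def)
    moreover have "\<forall>\<^sub>F s in at_left t. s < t"
      by (simp add: eventually_at_filter)
    ultimately show "\<forall>\<^sub>F s in at_left t. 0 \<le> L (\<lambda>n. c s n - x n) / (s - t)"
      by eventually_elim (use L_le in \<open>auto simp: zero_le_divide_iff\<close>)
  qed auto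
  ultimately show ?thesis by (simp add: L_def x_def)
qed

section \<open>Curves in the positive sphere with prescribed velocity\<close>

lemma lq_norm_tendsto_0I:
  assumes "0 < q" "((\<lambda>s. \<Sum>n. \<bar>f s n\<bar> powr q) \<longlongrightarrow> 0) F" "\<forall>\<^sub>F s in F. f s \<in> lq q"
  shows "((\<lambda>s. lq_norm q (f s)) \<longlongrightarrow> 0) F"
proof -
  \<comment> \<open>The limit base is 0, where continuity of the power is used from the nonnegative
    side; membership in \<open>lq\<close> supplies the sign of the sums.\<close>
  have "((\<lambda>s. (\<Sum>n. \<bar>f s n\<bar> powr q) powr (1/q)) \<longlongrightarrow> 0 powr (1/q)) F"
  proof (rule tendsto_powr2[OF assms(2) tendsto_const])
    show "\<forall>\<^sub>F s in F. 0 \<le> (\<Sum>n. \<bar>f s n\<bar> powr q)"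
      using assms(3) by eventually_elim (auto simp: lq_def intro!: suminf_nonneg)
  qed (use assms in simp)
  then show ?thesis
    by (simp add: lq_norm_def)
qed

text \<open>
  A straight line from a point of the positive sphere can leave the positive cone at once, since
  \<open>w n / x n\<close> may be unbounded. Suppressing, at time \<open>s\<close>, the coordinates in which the line has
  moved too far changes neither the velocity at \<open>0\<close> nor positivity.
\<close>

definition damped :: "seq \<Rightarrow> seq \<Rightarrow> real \<Rightarrow> seq" where
  "damped x w s = (\<lambda>n. if \<bar>s * w n\<bar> \<le> x n / 2 then w n else 0)"

text \<open>The \<open>q\<close>-th power of the norm of the damped line, whose coordinates are
  positive for positive \<open>x\<close>.\<close>

definition damped_mass :: "real \<Rightarrow> seq \<Rightarrow> seq \<Rightarrow> real \<Rightarrow> real" where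
  "damped_mass q x w s = (\<Sum>n. (x n + s * damped x w s n) powr q)"

text \<open>The damped line divided by its \<open>lq\<close> norm, that is, projected radially to
  the sphere.\<close>

definition damped_curve :: "real \<Rightarrow> seq \<Rightarrow> seq \<Rightarrow> real \<Rightarrow> seq" where
  "damped_curve q x w s =
     (\<lambda>n. damped_mass q x w s powr (- 1 / q) * (x n + s * damped x w s n))"

lemma damped_le: "\<bar>damped x w s n\<bar> \<le> \<bar>w n\<bar>"
  by (simp add: damped_def)

lemma damped_step_le: "0 < x n \<Longrightarrow> \<bar>s * damped x w s n\<bar> \<le> x n / 2"
  by (simp add: damped_def)

text \<open>How small \<open>s\<close> must be depends on \<open>n\<close>, and no common threshold
  need exist. Hence limits of series over \<open>n\<close> go through domination.\<close>

lemma eventually_damped_eq: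
  assumes "0 < x n"
  shows "\<forall>\<^sub>F s in at 0. damped x w s n = w n"
proof -
  have "((\<lambda>s. \<bar>s * w n\<bar>) \<longlongrightarrow> \<bar>0 * w n\<bar>) (at 0)"
    by (intro tendsto_intros)
  then have "\<forall>\<^sub>F s in at 0. \<bar>s * w n\<bar> < x n / 2"
    using assms by (intro order_tendstoD(2)) auto
  then show ?thesis
    by eventually_elim (simp add: damped_def)
qed

lemma damped_step_pos: "0 < x n \<Longrightarrow> 0 < x n + s * damped x w s n"
  using damped_step_le[of x n s w] by linarith

context
  fixes q :: real and x w :: seq
  assumes q: "1 < q" and x: "x \<in> pos_sphere q" and w: "w \<in> lq q"
begin

private lemma xD: "x \<in> lq q" "\<And>n. 0 < x n" "summable (\<lambda>n. x n powr q)" "(\<Sum>n. x n powr q) = 1"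
  using pos_sphereD[OF _ x] q by auto

lemma damped_step_lq: "(\<lambda>n. x n + s * damped x w s n) \<in> lq q"
  using q xD(1) lq_scale[OF lq_bound[OF w _ damped_le[of x w s]]] by (intro lq_add) auto

lemma summable_damped_mass: "summable (\<lambda>n. (x n + s * damped x w s n) powr q)"
  using damped_step_lq[of s] damped_step_pos[of x _ s w] xD(2) by (simp add: lq_def less_imp_le)

lemma damped_mass_pos: "0 < damped_mass q x w s"
  unfolding damped_mass_def
  using summable_damped_mass damped_step_pos[of x _ s w] xD(2)
  by (intro suminf_pos) (auto simp: less_imp_neq[symmetric])

lemma damped_mass_0: "damped_mass q x w 0 = 1"
  using xD by (simp add: damped_mass_def)

lemma damped_curve_0: "damped_curve q x w 0 = x"
  by (simp add: damped_curve_def damped_mass_0)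

lemma damped_curve_pos_sphere: "damped_curve q x w s \<in> pos_sphere q"
proof -
  let ?m = "damped_mass q x w s"
  have pos: "0 < damped_curve q x w s n" for n
    using damped_mass_pos[of s] damped_step_pos[of x n s w] xD(2) by (simp add: damped_curve_def)
  have "\<bar>damped_curve q x w s n\<bar> powr q = inverse ?m * (x n + s * damped x w s n) powr q" for n
    using pos[of n] damped_mass_pos[of s] damped_step_pos[of x n s w] xD(2) q
    by (simp add: damped_curve_def powr_mult powr_powr less_imp_le abs_mult powr_neg_one inverse_eq_divide)
  then have "(\<Sum>n. \<bar>damped_curve q x w s n\<bar> powr q) = inverse ?m * ?m"
    using summable_damped_mass[of s] by (simp add: suminf_mult damped_mass_def)
  then have "(\<Sum>n. \<bar>damped_curve q x w s n\<bar> powr q) = 1"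
    using damped_mass_pos[of s] by simp
  moreover have "damped_curve q x w s \<in> lq q"
    unfolding damped_curve_def by (intro lq_scale damped_step_lq)
  ultimately show ?thesis
    using pos by (simp add: pos_sphere_def lq_sphereI)
qed

text \<open>Termwise differentiation by dominated convergence. For annihilated \<open>w\<close> the
  derivative is 0, so normalising alters the damped line only by a term of order
  \<open>o(s)\<close>.\<close>

lemma damped_mass_derivative:
  "(damped_mass q x w has_real_derivative q * (\<Sum>n. x n powr (q - 1) * w n)) (at 0)"
proof -
  let ?a = "\<lambda>n s. ((x n + s * damped x w s n) powr q - x n powr q) / s"
  have "((\<lambda>s. \<Sum>n. ?a n s) \<longlongrightarrow> (\<Sum>n. q * (x n powr (q - 1) * w n))) (at 0)"
  proof (rule tendsto_suminf_dominated)
    fix n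
    have "((\<lambda>s. (x n + s * w n) powr q) has_real_derivative q * (x n powr (q - 1) * w n)) (at 0)"
      using xD(2)[of n] by (auto intro!: derivative_eq_intros simp: powr_diff)
    then have "((\<lambda>s. ((x n + s * w n) powr q - x n powr q) / s) \<longlongrightarrow> q * (x n powr (q - 1) * w n)) (at 0)"
      by (simp add: has_field_derivative_iff)
    moreover have "\<forall>\<^sub>F s in at 0. ((x n + s * w n) powr q - x n powr q) / s = ?a n s"
      using eventually_damped_eq[of x n w, OF xD(2)] by (rule eventually_mono) simp
    ultimately show "(?a n \<longlongrightarrow> q * (x n powr (q - 1) * w n)) (at 0)"
      by (rule Lim_transform_eventually)
  next
    \<comment> \<open>Damping keeps each perturbed coordinate at most \<open>3 / 2 * x n\<close>,
      and \<open>powr_diff_bound\<close> with this \<open>b\<close> gives the constant.\<close>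
    let ?C = "q * (3 / 2) powr (q - 1)"
    have "\<bar>?a n s\<bar> \<le> ?C * (x n powr (q - 1) * \<bar>w n\<bar>)" if "s \<noteq> 0" for n s
    proof -
      have "\<bar>(x n + s * damped x w s n) powr q - x n powr q\<bar>
          \<le> q * (3 / 2 * x n) powr (q - 1) * \<bar>(x n + s * damped x w s n) - x n\<bar>"
        using damped_step_le[of x n s w] damped_step_pos[of x n s w] xD(2)[of n] q
        by (intro powr_diff_bound) auto
      also have "\<dots> \<le> q * (3 / 2 * x n) powr (q - 1) * (\<bar>s\<bar> * \<bar>w n\<bar>)"
        using q damped_le[of x w s n] by (intro mult_left_mono) (auto simp: abs_mult intro!: mult_left_mono)
      finally show ?thesis
        unfolding powr_mult using that by (simp add: abs_divide divide_le_eq mult_ac)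
    qed
    then show "\<forall>\<^sub>F s in at 0. \<forall>n. \<bar>?a n s\<bar> \<le> ?C * (x n powr (q - 1) * \<bar>w n\<bar>)"
      by (auto simp: eventually_at_filter)
    show "summable (\<lambda>n. ?C * (x n powr (q - 1) * \<bar>w n\<bar>))"
      using summable_dual(1)[OF q x w] by (rule summable_mult)
  qed simp
  moreover have "(\<Sum>n. ?a n s) = (damped_mass q x w s - damped_mass q x w 0) / s" for s
    using suminf_divide[OF summable_diff[OF summable_damped_mass[of s] xD(3)], of s]
      suminf_diff[OF summable_damped_mass[of s] xD(3)] xD(4)
    by (simp add: damped_mass_0 damped_mass_def)
  ultimately show ?thesis
    using summable_dual(2)[OF q x w] by (simp add: has_field_derivative_iff suminf_mult)
qed

lemma damped_curve_velocity:
  assumes "(\<Sum>n. x n powr (q - 1) * w n) = 0"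
  shows "lq_velocity q (pos_sphere q) (damped_curve q x w) 0 w"
proof -
  define N where "N s = damped_mass q x w s powr (- 1 / q)" for s
  define e where "e s = (N s - 1) / s" for s
  let ?d = "\<lambda>s n. (damped_curve q x w s n - damped_curve q x w 0 n) / (s - 0) - w n"
  have N0: "N 0 = 1"
    by (simp add: N_def damped_mass_0)
  \<comment> \<open>The hypothesis on \<open>w\<close> enters here, through the vanishing derivative
    of the mass.\<close>
  have "(N has_real_derivative 0) (at 0)"
    using DERIV_fun_powr[OF damped_mass_derivative damped_mass_pos[of 0], of "- 1 / q"] assms
    unfolding N_def by simp
  then have e: "(e \<longlongrightarrow> 0) (at 0)" and N: "(N \<longlongrightarrow> 1) (at 0)"
    using DERIV_isCont[of N 0 0] N0 by (simp_all add: has_field_derivative_iff isCont_def e_def[abs_def])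
  \<comment> \<open>Split \<open>N s * (x n + s * damped x w s n) - x n\<close> into a moved part
    and the change of scale \<open>(N s - 1) * x n\<close>, then divide by \<open>s\<close>.\<close>
  have d: "?d s n = damped x w s n * N s + x n * e s - w n" if "s \<noteq> 0" for s n
    using that by (simp add: damped_curve_0) (simp add: damped_curve_def e_def N_def field_simps)
  have mem: "?d s \<in> lq q" for s
    using lq_diff[OF _ lq_scale[OF lq_diff[OF _ pos_sphereD(1)[OF _ damped_curve_pos_sphere[of s]]
      pos_sphereD(1)[OF _ damped_curve_pos_sphere[of 0]]], of "1 / s"] w] q by simp
  have "((\<lambda>s. \<Sum>n. \<bar>?d s n\<bar> powr q) \<longlongrightarrow> (\<Sum>n. 0)) (at 0)"
  proof (rule tendsto_suminf_dominated)
    fix n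
    have "((\<lambda>s. w n * N s + x n * e s - w n) \<longlongrightarrow> w n * 1 + x n * 0 - w n) (at 0)"
      by (intro tendsto_intros e N)
    then have "((\<lambda>s. w n * N s + x n * e s - w n) \<longlongrightarrow> 0) (at 0)"
      by simp
    moreover have "\<forall>\<^sub>F s in at 0. w n * N s + x n * e s - w n = ?d s n"
      using eventually_damped_eq[of x n w, OF xD(2)] eventually_neq_at_within[of 0]
    proof eventually_elim
      case (elim s)
      show ?case
        unfolding d[OF elim(2)] elim(1) ..
    qed
    ultimately have "((\<lambda>s. ?d s n) \<longlongrightarrow> 0) (at 0)"
      by (rule Lim_transform_eventually)
    then have "((\<lambda>s. \<bar>?d s n\<bar>) \<longlongrightarrow> 0) (at 0)"
      by (rule tendsto_rabs_zero)
    from tendsto_powr2[OF this tendsto_const[of q]]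
    show "((\<lambda>s. \<bar>?d s n\<bar> powr q) \<longlongrightarrow> 0) (at 0)"
      using q by simp
  next
    have "\<forall>\<^sub>F s in at 0. \<bar>N s\<bar> < 2" "\<forall>\<^sub>F s in at 0. \<bar>e s\<bar> < 1"
      using order_tendstoD(2)[OF tendsto_rabs[OF N], of 2] order_tendstoD(2)[OF tendsto_rabs[OF e], of 1]
      by auto
    \<comment> \<open>The three terms of the decomposition are at most
      \<open>2 * \<bar>w n\<bar>\<close>, \<open>x n\<close> and
      \<open>\<bar>w n\<bar>\<close>.\<close>
    then show "\<forall>\<^sub>F s in at 0. \<forall>n. \<bar>\<bar>?d s n\<bar> powr q\<bar> \<le> \<bar>3 * \<bar>w n\<bar> + x n\<bar> powr q"
      using eventually_neq_at_within[of 0]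
    proof eventually_elim
      case (elim s)
      show ?case
      proof
        fix n
        have "\<bar>damped x w s n * N s\<bar> \<le> \<bar>w n\<bar> * 2"
          unfolding abs_mult using elim damped_le[of x w s n] by (intro mult_mono) auto
        moreover have "\<bar>x n * e s\<bar> \<le> x n * 1"
          unfolding abs_mult using elim xD(2)[of n] by (intro mult_mono) auto
        ultimately have "\<bar>?d s n\<bar> \<le> \<bar>3 * \<bar>w n\<bar> + x n\<bar>"
          unfolding d[OF elim(3)] by linarith
        then show "\<bar>\<bar>?d s n\<bar> powr q\<bar> \<le> \<bar>3 * \<bar>w n\<bar> + x n\<bar> powr q"
          using q by (simp add: powr_mono2)
      qed
    qed
    have "(\<lambda>n. 3 * \<bar>w n\<bar> + x n) \<in> lq q"
      using q w xD(1) by (intro lq_add lq_scale lq_abs) auto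
    then show "summable (\<lambda>n. \<bar>3 * \<bar>w n\<bar> + x n\<bar> powr q)"
      by (simp add: lq_def)
  qed simp
  then have "((\<lambda>s. lq_norm q (?d s)) \<longlongrightarrow> 0) (at 0)"
    using q mem by (intro lq_norm_tendsto_0I) auto
  then show ?thesis
    using w damped_curve_pos_sphere by (simp add: lq_velocity_def)
qed

end

section \<open>Tangent spaces of the sphere at positive points\<close>

lemma lq_velocity_mono: "A \<subseteq> B \<Longrightarrow> lq_velocity q A c t w \<Longrightarrow> lq_velocity q B c t w"
  by (auto simp: lq_velocity_def elim: eventually_mono)

lemma pos_sphere_subset: "pos_sphere q \<subseteq> lq_sphere q"
  by (auto simp: pos_sphere_def)

text \<open>One inclusion treats every curve in the whole sphere, the other builds a curve that
  stays positive. At a positive point both kinds of curves thus have the same velocities.\<close>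

lemma sphere_tangent_eq:
  assumes "1 < q" "x \<in> pos_sphere q"
  shows "sphere_tangent q x = {w \<in> lq q. (\<Sum>n. x n powr (q - 1) * w n) = 0}"
proof (intro equalityI subsetI)
  fix w assume "w \<in> sphere_tangent q x"
  then obtain c where "c 0 = x" "lq_velocity q (lq_sphere q) c 0 w"
    by (auto simp: sphere_tangent_def)
  then show "w \<in> {w \<in> lq q. (\<Sum>n. x n powr (q - 1) * w n) = 0}"
    using dual_velocity_eq_0[of q c 0 w] assms by (auto simp: lq_velocity_def)
next
  fix w assume "w \<in> {w \<in> lq q. (\<Sum>n. x n powr (q - 1) * w n) = 0}"
  then have "lq_velocity q (lq_sphere q) (damped_curve q x w) 0 w" "damped_curve q x w 0 = x"
    using damped_curve_velocity[OF assms] damped_curve_0[OF assms]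
      lq_velocity_mono[OF pos_sphere_subset] by auto
  then show "w \<in> sphere_tangent q x"
    by (auto simp: sphere_tangent_def)
qed

section \<open>The root transform as a bijection\<close>

lemma simplexD:
  assumes "p \<in> simplex"
  shows "0 < p n" "summable p" "(\<Sum>n. p n) = 1"
proof -
  show "0 < p n" "(\<Sum>n. p n) = 1"
    using assms by (auto simp: simplex_def)
  have "\<bar>p n\<bar> powr 1 = p n" for n
    using assms by (simp add: simplex_def less_imp_le)
  then show "summable p"
    using assms by (simp add: simplex_def lq_def)
qed

text \<open>The second identity makes the weights of the differential and of its inverse
  reciprocal.\<close>

lemma root_transform_powr:
  assumes "0 < q" "p \<in> simplex"
  shows "root_transform q p n powr q = p n"
    "root_transform q p n powr (q - 1) * p n powr (1/q - 1) = 1"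
proof -
  have p: "0 < p n"
    using simplexD(1)[OF assms(2)] .
  show "root_transform q p n powr q = p n"
    using assms p by (simp add: root_transform_def powr_powr)
  have "root_transform q p n powr (q - 1) * p n powr (1/q - 1)
      = p n powr (1 / q * (q - 1) + (1/q - 1))"
    by (simp add: root_transform_def powr_powr powr_add)
  also have "1 / q * (q - 1) + (1/q - 1) = 0"
    using assms by (simp add: field_simps)
  finally show "root_transform q p n powr (q - 1) * p n powr (1/q - 1) = 1"
    using p by simp
qed

lemma root_transform_pos_sphere:
  assumes "0 < q" "p \<in> simplex"
  shows "root_transform q p \<in> pos_sphere q"
proof -
  note p = simplexD[OF assms(2)]
  have pos: "0 < root_transform q p n" for n
    using p(1)[of n] by (simp add: root_transform_def)
  then have "\<bar>root_transform q p n\<bar> powr q = p n" for n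
    using root_transform_powr(1)[OF assms, of n] by (simp add: abs_of_pos)
  then show ?thesis
    using p pos by (auto simp: pos_sphere_def lq_def intro!: lq_sphereI)
qed

lemma powr_simplex:
  assumes "0 < q" "x \<in> pos_sphere q"
  shows "(\<lambda>n. x n powr q) \<in> simplex" "root_transform q (\<lambda>n. x n powr q) = x"
  using pos_sphereD[OF assms] assms(1)
  by (auto simp: simplex_def lq_def root_transform_def powr_powr less_imp_le less_imp_neq[symmetric])

lemma bij_betw_root_transform:
  assumes "0 < q"
  shows "bij_betw (root_transform q) simplex (pos_sphere q)"
  by (rule bij_betw_byWitness[where f' = "\<lambda>x n. x n powr q"])
    (use assms root_transform_powr(1)[OF assms] powr_simplex[OF assms]
      root_transform_pos_sphere[OF assms] in auto)

section \<open>The differential of the root transform and its inverse\<close>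

definition root_differential :: "real \<Rightarrow> seq \<Rightarrow> seq \<Rightarrow> seq" where
  "root_differential q p v = (\<lambda>n. (1 / q) * (v n * p n powr (1 / q - 1)))"

text \<open>The differential of the inverse map \<open>\<lambda>x n. x n powr q\<close> at the point
  \<open>root_transform q p\<close>.\<close>

definition root_codifferential :: "real \<Rightarrow> seq \<Rightarrow> seq \<Rightarrow> seq" where
  "root_codifferential q p w = (\<lambda>n. q * (root_transform q p n powr (q - 1) * w n))"

lemma root_differential_inverse:
  assumes "0 < q" "p \<in> simplex"
  shows "root_differential q p (root_codifferential q p w) = w"
    "root_codifferential q p (root_differential q p v) = v"
  using root_transform_powr(2)[OF assms] assms(1)
  by (auto simp: root_differential_def root_codifferential_def mult_ac fun_eq_iff)

text \<open>Norm velocity of the curve of roots gives coordinatewise derivatives, and the chain rule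
  for the \<open>q\<close>-th power carries them back to the simplex.\<close>

lemma simplex_velocityI:
  assumes "0 < q" "\<forall>\<^sub>F s in nhds t. c s \<in> simplex"
    and "lq_velocity q (pos_sphere q) (root_transform q \<circ> c) t w"
  shows "simplex_velocity q c t (root_codifferential q (c t) w)"
proof -
  have ct: "c t \<in> simplex"
    using eventually_nhds_x_imp_x[OF assms(2)] .
  have sub: "pos_sphere q \<subseteq> lq q"
    by (auto simp: pos_sphere_def lq_sphere_def)
  have "((\<lambda>s. c s n) has_real_derivative root_codifferential q (c t) w n) (at t)" for n
  proof -
    have pos: "0 < root_transform q (c t) n"
      using simplexD(1)[OF ct, of n] by (simp add: root_transform_def)
    have "((\<lambda>s. root_transform q (c s) n powr q) has_real_derivative
        root_codifferential q (c t) w n) (at t)"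
      using DERIV_fun_powr[OF lq_velocity_coordinate[OF assms(1) sub assms(3), of n], of q] pos
      by (simp add: root_codifferential_def mult_ac)
    moreover have ev: "\<forall>\<^sub>F s in nhds t. root_transform q (c s) n powr q = c s n"
      using assms(2) by eventually_elim (use root_transform_powr(1)[OF assms(1)] in auto)
    ultimately show ?thesis
      using DERIV_cong_ev[OF refl ev refl] by simp
  qed
  then show ?thesis
    using assms by (auto simp: simplex_velocity_def)
qed

text \<open>\<open>simplex_velocity\<close> provides only some velocity \<open>w\<close> of the
  curve of roots. Uniqueness of the coordinate derivatives forces \<open>v\<close> to be the
  codifferential of \<open>w\<close>, which inverts to the claim.\<close>

lemma simplex_velocityD:
  assumes "0 < q" "simplex_velocity q c t v"
  shows "lq_velocity q (pos_sphere q) (root_transform q \<circ> c) t (root_differential q (c t) v)"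
proof -
  obtain w where ev: "\<forall>\<^sub>F s in nhds t. c s \<in> simplex"
    and w: "lq_velocity q (pos_sphere q) (root_transform q \<circ> c) t w"
    using assms(2) by (auto simp: simplex_velocity_def)
  have "v = root_codifferential q (c t) w"
    using simplex_velocityI[OF assms(1) ev w] assms(2)
    by (auto simp: simplex_velocity_def intro: DERIV_unique)
  then show ?thesis
    using w root_differential_inverse[OF assms(1) eventually_nhds_x_imp_x[OF ev]] by simp
qed

text \<open>With \<open>w\<close> the image of \<open>v\<close>, the weighted condition on
  \<open>v\<close> is \<open>w \<in> lq q\<close> up to the factor \<open>q\<close>. Then
  \<open>v\<close> is \<open>q\<close> times the summand of the supporting functional at
  \<open>w\<close>, so \<open>summable_dual\<close> gives absolute summability and the two sums
  vanish together.\<close>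

lemma simplex_tangent_iff:
  assumes "1 < q" "p \<in> simplex"
  shows "v \<in> simplex_tangent q p
    \<longleftrightarrow> root_differential q p v \<in> sphere_tangent q (root_transform q p)"
proof -
  define x where "x = root_transform q p"
  define w where "w = root_differential q p v"
  have x: "x \<in> pos_sphere q"
    using root_transform_pos_sphere assms by (simp add: x_def)
  have v: "v = (\<lambda>n. q * (x n powr (q - 1) * w n))"
    using root_differential_inverse(2)[OF _ assms(2), of q v] assms(1)
    by (simp add: root_codifferential_def x_def w_def)
  have "w \<in> lq q \<longleftrightarrow> (\<lambda>n. v n * p n powr (1 / q - 1)) \<in> lq q"
  proof
    assume "w \<in> lq q"
    from lq_scale[OF this, of q] show "(\<lambda>n. v n * p n powr (1 / q - 1)) \<in> lq q"
      using assms(1) by (simp add: w_def root_differential_def)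
  qed (unfold w_def root_differential_def, rule lq_scale)
  moreover have "v \<in> lq 1" "(\<Sum>n. v n) = q * (\<Sum>n. x n powr (q - 1) * w n)" if "w \<in> lq q"
  proof -
    have "summable (\<lambda>n. q * (x n powr (q - 1) * \<bar>w n\<bar>))"
      using summable_dual(1)[OF assms(1) x that] by (rule summable_mult)
    then show "v \<in> lq 1"
      using assms(1) by (simp add: v lq_def abs_mult)
    show "(\<Sum>n. v n) = q * (\<Sum>n. x n powr (q - 1) * w n)"
      using summable_dual(2)[OF assms(1) x that] by (simp add: v suminf_mult)
  qed
  ultimately show ?thesis
    using assms(1) unfolding sphere_tangent_eq[OF assms(1) x, unfolded x_def] simplex_tangent_def
    by (auto simp: w_def x_def)
qed

lemma bij_betw_root_differential:
  assumes "1 < q" "p \<in> simplex"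
  shows "bij_betw (root_differential q p) (simplex_tangent q p)
    (sphere_tangent q (root_transform q p))"
  by (rule bij_betw_byWitness[where f' = "root_codifferential q p"])
    (use assms simplex_tangent_iff[OF assms] root_differential_inverse[of q p] in auto)

lemma fisher_rao_eq:
  assumes "1 < q" "p \<in> simplex" "v \<in> simplex_tangent q p"
  shows "fisher_rao q p v = q * lq_norm q (root_differential q p v)"
proof -
  have mem: "(\<lambda>n. v n * p n powr (1 / q - 1)) \<in> lq q"
    using assms(3) by (simp add: simplex_tangent_def)
  have "\<bar>v n / p n\<bar> powr q * p n = \<bar>v n * p n powr (1 / q - 1)\<bar> powr q" for n
  proof -
    have p: "0 < p n"
      using simplexD(1)[OF assms(2)] .
    \<comment> \<open>The outer factor \<open>p n\<close> of the metric is
      \<open>(p n powr (1 / q)) powr q\<close> and moves inside the power.\<close>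
    then have *: "\<bar>v n * p n powr (1 / q - 1)\<bar> = \<bar>v n / p n\<bar> * p n powr (1 / q)"
      by (simp add: powr_diff abs_mult)
    show ?thesis
      unfolding * powr_mult using p assms(1) by (simp add: powr_powr)
  qed
  then have "fisher_rao q p v = lq_norm q (\<lambda>n. v n * p n powr (1 / q - 1))"
    by (simp add: fisher_rao_def lq_norm_def)
  then show ?thesis
    using lq_norm_scale[OF _ mem, of "1 / q"] assms(1) by (simp add: root_differential_def)
qed

text \<open>The curve consists of the coordinatewise \<open>q\<close>-th powers of the damped curve
  for the transported vector; it makes the differential unique on the tangent space.\<close>

lemma simplex_velocity_exists:
  assumes "1 < q" "p \<in> simplex" "v \<in> simplex_tangent q p"
  shows "\<exists>c. c 0 = p \<and> simplex_velocity q c 0 v"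
proof -
  let ?x = "root_transform q p" and ?w = "root_differential q p v"
  let ?z = "damped_curve q ?x ?w"
  let ?c = "\<lambda>s n. ?z s n powr q"
  have q: "0 < q" using assms(1) by simp
  have x: "?x \<in> pos_sphere q"
    using root_transform_pos_sphere[OF q assms(2)] .
  have w: "?w \<in> lq q" "(\<Sum>n. ?x n powr (q - 1) * ?w n) = 0"
    using assms simplex_tangent_iff[OF assms(1,2)] sphere_tangent_eq[OF assms(1) x] by auto
  have z: "?z s \<in> pos_sphere q" for s
    using damped_curve_pos_sphere[OF assms(1) x w(1)] .
  have "root_transform q \<circ> ?c = ?z"
    using powr_simplex(2)[OF q z] by (simp add: fun_eq_iff)
  then have vel: "lq_velocity q (pos_sphere q) (root_transform q \<circ> ?c) 0 ?w"
    using damped_curve_velocity[OF assms(1) x w] by simp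
  have c0: "?c 0 = p"
    using damped_curve_0[OF assms(1) x w(1)] root_transform_powr(1)[OF q assms(2)]
    by simp
  have "simplex_velocity q ?c 0 (root_codifferential q (?c 0) ?w)"
    using powr_simplex(1)[OF q z] by (intro simplex_velocityI[OF q _ vel]) simp
  then show ?thesis
    using c0 root_differential_inverse(2)[OF q assms(2)] by (intro exI[of _ ?c]) simp
qed

section \<open>Assembly of the isometry\<close>

lemma is_differential_root:
  assumes "1 < q" "p \<in> simplex"
  shows "is_differential (simplex_finsler q) (scale_metric q (pos_sphere_finsler q))
    (root_transform q) p (root_differential q p)"
proof -
  have "v \<in> simplex_tangent q p"
    "lq_velocity q (pos_sphere q) (root_transform q \<circ> c) t (root_differential q p v)"
    if "c t = p" "simplex_velocity q c t v" for c t v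
  proof -
    show vel: "lq_velocity q (pos_sphere q) (root_transform q \<circ> c) t (root_differential q p v)"
      using simplex_velocityD[OF _ that(2)] assms(1) that(1) by simp
    have x: "root_transform q p \<in> pos_sphere q"
      using root_transform_pos_sphere assms by simp
    have "(\<Sum>n. root_transform q p n powr (q - 1) * root_differential q p v n) = 0"
      using dual_velocity_eq_0[OF assms(1) _ lq_velocity_mono[OF pos_sphere_subset vel]] x that(1)
      by simp
    then show "v \<in> simplex_tangent q p"
      using vel by (simp add: simplex_tangent_iff[OF assms] sphere_tangent_eq[OF assms(1) x] lq_velocity_def)
  qed
  then show ?thesis
    using simplex_velocity_exists[OF assms]
    by (simp add: is_differential_def simplex_finsler_def scale_metric_def pos_sphere_finsler_def)
      blast
qed

theorem theorem2:
  fixes q :: real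
  assumes "1 < q"
  shows "finsler_isometry (simplex_finsler q) (scale_metric q (pos_sphere_finsler q))
           (root_transform q)"
proof -
  let ?M = "simplex_finsler q" and ?N = "scale_metric q (pos_sphere_finsler q)"
  note defs = simplex_finsler_def scale_metric_def pos_sphere_finsler_def
  have q: "0 < q" using assms by simp
  \<comment> \<open>Velocities go forward through the differential and back through the
    codifferential.\<close>
  have "differentiable_curve ?M c t \<longleftrightarrow> differentiable_curve ?N (root_transform q \<circ> c) t"
    if "\<forall>\<^sub>F s in nhds t. c s \<in> simplex" for c t
    using simplex_velocityD[OF q, of c t] simplex_velocityI[OF q that]
    by (auto simp: differentiable_curve_def defs)
  then have "finsler_diffeo ?M ?N (root_transform q)"
    using bij_betw_root_transform[OF q] by (simp add: finsler_diffeo_def defs)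
  moreover have "\<exists>D. is_differential ?M ?N (root_transform q) p D \<and>
      linear_on_seqs (tangent ?M p) D \<and>
      bij_betw D (tangent ?M p) (tangent ?N (root_transform q p)) \<and>
      (\<forall>v \<in> tangent ?M p. fnorm ?N (root_transform q p) (D v) = fnorm ?M p v)"
    if "p \<in> points ?M" for p
  proof (intro exI conjI)
    have p: "p \<in> simplex" using that by (simp add: defs)
    show "is_differential ?M ?N (root_transform q) p (root_differential q p)"
      using is_differential_root[OF assms p] .
    show "linear_on_seqs (tangent ?M p) (root_differential q p)"
      by (simp add: linear_on_seqs_def root_differential_def algebra_simps add_divide_distrib)
    show "bij_betw (root_differential q p) (tangent ?M p) (tangent ?N (root_transform q p))"
      using bij_betw_root_differential[OF assms p] by (simp add: defs)
    show "\<forall>v \<in> tangent ?M p. fnorm ?N (root_transform q p) (root_differential q p v) = fnorm ?M p v"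
      using fisher_rao_eq[OF assms p] by (simp add: defs)
  qed
  ultimately show ?thesis
    unfolding finsler_isometry_def by blast
qed

end
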